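(* Let $A=\mathcal{C}^\infty(\mathbb{R}^2,\mathbb{R})$ with coordinates $(x,p)$ on $\mathbb{R}^2$, let $R=A[[\lambda]]$ be equipped with the $\mathbb{R}[[\lambda]]$-bilinear star product determined by $$f\star g=\sum_{k=0}^\infty\frac{\lambda^k}{k!}\frac{\partial^kf}{\partial p^k}\frac{\partial^kg}{\partial x^k}\qquad(f,g\in A),$$ and let $\Omega=\{(x,p)\in\mathbb{R}^2\mid x\neq0\}$. Put $S_0=\{1,x,x^2,\dots\}\subset A$, $S=S_0+\lambda R\subset R$, and $S_\Omega=\{g\in A\mid g(y)\neq0\text{ for all }y\in\Omega\}$. Then $S$ is a multiplicative subset of $(R,\star)$ which is contained in the right denominator subset $S_\Omega+\lambda R$ of $R$, but $S$ is neither right nor left Ore.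
   Context: A multiplicative subset of an algebra $R$ is a subset containing $1$ and closed under multiplication. A multiplicative subset $S$ of $R$ is right Ore if for all $r\in R$ and $s\in S$ there are $r'\in R$ and $s'\in S$ with $rs'=sr'$; it is left Ore if for all $r\in R$ and $s\in S$ there are $r'\in R$ and $s'\in S$ with $s'r=r's$. It is a right denominator set if it is right Ore and right reversible, i.e. for all $r\in R$, $s'\in S$ with $s'r=0$ there is $s\in S$ with $rs=0$. All products in $R$ are taken with respect to $\star$. For formal power series, $(f\star g)_n=\sum_{k+i+j=n}\frac{1}{k!}\,\partial_p^kf_i\,\partial_x^kg_j$. *)

theory Defs
  imports
    "HOL-Analysis.Analysis"
    "HOL-Algebra.Ring"
    "HOL-Library.Function_Algebras"
    "HOL-Computational_Algebra.Formal_Power_Series"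
begin

section \<open>Ore and denominator conditions in a ring\<close>

definition multiplicative_subset :: "('a, 'b) ring_scheme \<Rightarrow> 'a set \<Rightarrow> bool" where
  "multiplicative_subset R S \<longleftrightarrow>
     S \<subseteq> carrier R \<and> \<one>\<^bsub>R\<^esub> \<in> S \<and> (\<forall>s\<in>S. \<forall>t\<in>S. s \<otimes>\<^bsub>R\<^esub> t \<in> S)"

definition right_Ore :: "('a, 'b) ring_scheme \<Rightarrow> 'a set \<Rightarrow> bool" where
  "right_Ore R S \<longleftrightarrow>
     (\<forall>r\<in>carrier R. \<forall>s\<in>S. \<exists>r'\<in>carrier R. \<exists>s'\<in>S. r \<otimes>\<^bsub>R\<^esub> s' = s \<otimes>\<^bsub>R\<^esub> r')"

definition left_Ore :: "('a, 'b) ring_scheme \<Rightarrow> 'a set \<Rightarrow> bool" where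
  "left_Ore R S \<longleftrightarrow>
     (\<forall>r\<in>carrier R. \<forall>s\<in>S. \<exists>r'\<in>carrier R. \<exists>s'\<in>S. s' \<otimes>\<^bsub>R\<^esub> r = r' \<otimes>\<^bsub>R\<^esub> s)"

definition right_reversible :: "('a, 'b) ring_scheme \<Rightarrow> 'a set \<Rightarrow> bool" where
  "right_reversible R S \<longleftrightarrow>
     (\<forall>r\<in>carrier R. \<forall>s'\<in>S. s' \<otimes>\<^bsub>R\<^esub> r = \<zero>\<^bsub>R\<^esub> \<longrightarrow> (\<exists>s\<in>S. r \<otimes>\<^bsub>R\<^esub> s = \<zero>\<^bsub>R\<^esub>))"

definition right_denominator_set :: "('a, 'b) ring_scheme \<Rightarrow> 'a set \<Rightarrow> bool" where
  "right_denominator_set R S \<longleftrightarrow>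
     multiplicative_subset R S \<and> right_Ore R S \<and> right_reversible R S"


section \<open>Smooth functions on the plane\<close>

text \<open>Points of the plane are pairs \<open>(x, p)\<close>. Functions carry the pointwise ring
  structure of \<open>Function_Algebras\<close>.\<close>

definition partial_x :: "(real \<times> real \<Rightarrow> real) \<Rightarrow> real \<times> real \<Rightarrow> real" where
  "partial_x f = (\<lambda>(x, p). deriv (\<lambda>t. f (t, p)) x)"

definition partial_p :: "(real \<times> real \<Rightarrow> real) \<Rightarrow> real \<times> real \<Rightarrow> real" where
  "partial_p f = (\<lambda>(x, p). deriv (\<lambda>t. f (x, t)) p)"

text \<open>The class \<open>C\<^sup>k\<close>. Since \<open>deriv\<close> is a total operator, existence of the derivatives has
  to be demanded explicitly; this is the role of \<open>differentiable_on\<close>.\<close>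

primrec C_class :: "nat \<Rightarrow> (real \<times> real \<Rightarrow> real) \<Rightarrow> bool" where
  "C_class 0 f \<longleftrightarrow> continuous_on UNIV f"
| "C_class (Suc k) f \<longleftrightarrow>
     f differentiable_on UNIV \<and> C_class k (partial_x f) \<and> C_class k (partial_p f)"

definition smooth_functions :: "(real \<times> real \<Rightarrow> real) set" where
  "smooth_functions = {f. \<forall>k. C_class k f}"


section \<open>The star product algebra\<close>

text \<open>The \<open>\<real>[[\<lambda>]]\<close>-bilinear extension of the star product, by coefficients. The index set is
  finite, see \<open>finite_star_index\<close>. The variable \<open>\<lambda>\<close> is \<open>fps_X\<close>, and \<open>*\<close> on power series
  stays the undeformed (commutative) product.\<close>

definition star :: "(real \<times> real \<Rightarrow> real) fps \<Rightarrow> (real \<times> real \<Rightarrow> real) fps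
    \<Rightarrow> (real \<times> real \<Rightarrow> real) fps" where
  "star F G = Abs_fps (\<lambda>n z. \<Sum>(k, i, j) \<in> {(k, i, j). k + i + j = n}.
     1 / fact k * (partial_p ^^ k) (fps_nth F i) z * (partial_x ^^ k) (fps_nth G j) z)"

lemma finite_star_index: "finite {(k, i, j). k + i + j = (n::nat)}"
  by (rule finite_subset[of _ "{..n} \<times> {..n} \<times> {..n}"]) auto

definition star_algebra :: "(real \<times> real \<Rightarrow> real) fps ring" where
  "star_algebra = \<lparr>carrier = {F. \<forall>n. fps_nth F n \<in> smooth_functions},
     mult = star, one = 1, zero = 0, add = (+)\<rparr>"

text \<open>\<open>plus_lambda T\<close> is \<open>T + \<lambda>R\<close>.\<close>

definition plus_lambda :: "(real \<times> real \<Rightarrow> real) set \<Rightarrow> (real \<times> real \<Rightarrow> real) fps set" where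
  "plus_lambda T = {fps_const f + fps_X * G | f G. f \<in> T \<and> G \<in> carrier star_algebra}"

definition x_powers :: "(real \<times> real \<Rightarrow> real) set" where
  "x_powers = range (\<lambda>n (x, p). x ^ n)"

definition \<Omega> :: "(real \<times> real) set" where
  "\<Omega> = {(x, p). x \<noteq> 0}"

definition nonvanishing_on :: "(real \<times> real) set \<Rightarrow> (real \<times> real \<Rightarrow> real) set" where
  "nonvanishing_on U = {g \<in> smooth_functions. \<forall>y\<in>U. g y \<noteq> 0}"

end

theory Submission
  imports Defs
begin

text \<open>Given \<open>r\<close> and \<open>s = s\<^sub>0 + \<dots>\<close>, take \<open>s' = exp (- 1 / s\<^sub>0\<^sup>2)\<close>, extended by zero. The smooth multiples of
  the functions \<open>s\<^sub>0 ^ (- 2 m) exp (- 1 / s\<^sub>0\<^sup>2)\<close> form an ideal that is stable under partial derivatives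
  and under division by \<open>s\<^sub>0\<close>, so \<open>r \<star> s' = s \<star> r'\<close> can be solved for \<open>r'\<close> inside it, coefficient by
  coefficient. Reversibility holds because \<open>\<Omega>\<close> is dense.

  Both Ore conditions for \<open>S\<close> fail for \<open>s = x\<close> and a function \<open>r\<close> of \<open>p\<close> alone having at each \<open>m \<in> \<nat>\<close> a zero of
  order exactly \<open>m\<close>. If \<open>s'\<^sub>0 = x ^ m\<close>, the coefficient of \<open>\<lambda> ^ m\<close> in \<open>r \<star> s' = x \<star> r'\<close>, evaluated at \<open>(0, m)\<close>,
  reduces to \<open>\<partial>\<^sub>p ^ m r = 0\<close>. In \<open>s' \<star> r = r' \<star> x\<close> the coefficients read
  \<open>x r'\<^sub>n = s'\<^sub>n r - \<partial>\<^sub>p r'\<^bsub>n-1\<^esub>\<close>; hence, near \<open>p = m\<close>, \<open>x ^ (n + 1) r'\<^sub>n\<close> is divisible by \<open>(p - m) ^ (m - n)\<close> with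
  quotient a nonzero multiple of \<open>x ^ m\<close> on \<open>p = m\<close>. For \<open>n = m\<close> this makes \<open>x r'\<^sub>m\<close> a nonzero constant
  on that line.\<close>

section \<open>Calculus of smooth functions\<close>

text \<open>Total differentiability restricts to horizontal lines by the chain rule, so the
  \<open>deriv\<close> inside \<open>partial_x\<close> is a genuine derivative.\<close>

lemma has_derivative_partial_x:
  assumes "f differentiable_on UNIV"
  shows "((\<lambda>t. f (t, p)) has_real_derivative partial_x f (x, p)) (at x)"
proof -
  have "f differentiable at (x, p)"
    using assms by (simp add: differentiable_on_def)
  moreover have "(\<lambda>t. (t, p)) differentiable at x"
    by (auto simp: differentiable_def intro!: derivative_eq_intros)
  ultimately have "(f \<circ> (\<lambda>t. (t, p))) differentiable at x"
    by (intro differentiable_chain_at) auto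
  then show ?thesis
    by (simp add: o_def partial_x_def DERIV_deriv_iff_real_differentiable)
qed

lemma has_derivative_partial_p:
  assumes "f differentiable_on UNIV"
  shows "((\<lambda>t. f (x, t)) has_real_derivative partial_p f (x, p)) (at p)"
proof -
  have "f differentiable at (x, p)"
    using assms by (simp add: differentiable_on_def)
  moreover have "(\<lambda>t. (x, t)) differentiable at p"
    by (auto simp: differentiable_def intro!: derivative_eq_intros)
  ultimately have "(f \<circ> (\<lambda>t. (x, t))) differentiable at p"
    by (intro differentiable_chain_at) auto
  then show ?thesis
    by (simp add: o_def partial_p_def DERIV_deriv_iff_real_differentiable)
qed

lemma partial_x_eqI:
  assumes "\<And>x p. ((\<lambda>t. f (t, p)) has_real_derivative g (x, p)) (at x)"
  shows "partial_x f = g"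
  using assms by (auto simp: partial_x_def fun_eq_iff intro!: DERIV_imp_deriv)

lemma partial_p_eqI:
  assumes "\<And>x p. ((\<lambda>t. f (x, t)) has_real_derivative g (x, p)) (at p)"
  shows "partial_p f = g"
  using assms by (auto simp: partial_p_def fun_eq_iff intro!: DERIV_imp_deriv)

lemma partial_const [simp]:
  "partial_x (\<lambda>z. c) = (\<lambda>z. 0)" "partial_p (\<lambda>z. c) = (\<lambda>z. 0)"
  by (auto intro!: partial_x_eqI partial_p_eqI)

lemma partial_zero [simp]: "partial_x 0 = 0" "partial_p 0 = 0"
  by (simp_all add: zero_fun_def)

lemma partial_x_add:
  assumes "f differentiable_on UNIV" "g differentiable_on UNIV"
  shows "partial_x (\<lambda>z. f z + g z) = (\<lambda>z. partial_x f z + partial_x g z)"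
  by (intro partial_x_eqI DERIV_add has_derivative_partial_x assms)

lemma partial_p_add:
  assumes "f differentiable_on UNIV" "g differentiable_on UNIV"
  shows "partial_p (\<lambda>z. f z + g z) = (\<lambda>z. partial_p f z + partial_p g z)"
  by (intro partial_p_eqI DERIV_add has_derivative_partial_p assms)

lemma partial_x_mult:
  assumes "f differentiable_on UNIV" "g differentiable_on UNIV"
  shows "partial_x (\<lambda>z. f z * g z) = (\<lambda>z. f z * partial_x g z + partial_x f z * g z)"
  by (intro partial_x_eqI DERIV_mult' has_derivative_partial_x assms)

lemma partial_p_mult:
  assumes "f differentiable_on UNIV" "g differentiable_on UNIV"
  shows "partial_p (\<lambda>z. f z * g z) = (\<lambda>z. f z * partial_p g z + partial_p f z * g z)"
  by (intro partial_p_eqI DERIV_mult' has_derivative_partial_p assms)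

lemma partial_x_compose:
  assumes "f differentiable_on UNIV" "\<And>u. (h has_real_derivative h' u) (at u)"
  shows "partial_x (\<lambda>z. h (f z)) = (\<lambda>z. h' (f z) * partial_x f z)"
  by (intro partial_x_eqI DERIV_chain2[OF assms(2)] has_derivative_partial_x assms)

lemma partial_p_compose:
  assumes "f differentiable_on UNIV" "\<And>u. (h has_real_derivative h' u) (at u)"
  shows "partial_p (\<lambda>z. h (f z)) = (\<lambda>z. h' (f z) * partial_p f z)"
  by (intro partial_p_eqI DERIV_chain2[OF assms(2)] has_derivative_partial_p assms)

section \<open>Closure properties of the classes \<open>C_class k\<close>\<close>

lemma C_class_Suc_imp: "C_class (Suc k) f \<Longrightarrow> C_class k f"
proof (induction k arbitrary: f)
  case 0
  then show ?case by (simp add: differentiable_imp_continuous_on)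
next
  case (Suc k)
  then have "C_class (Suc k) (partial_x f)" "C_class (Suc k) (partial_p f)"
    unfolding C_class.simps(2)[of "Suc k"] by blast+
  from this[THEN Suc.IH] Suc.prems show ?case by simp
qed

lemma C_class_const: "C_class k (\<lambda>z. c)"
  by (induction k arbitrary: c) auto

lemma C_class_add: "C_class k f \<Longrightarrow> C_class k g \<Longrightarrow> C_class k (\<lambda>z. f z + g z)"
  by (induction k arbitrary: f g)
    (auto simp: partial_x_add partial_p_add intro: continuous_on_add)

lemma C_class_mult: "C_class k f \<Longrightarrow> C_class k g \<Longrightarrow> C_class k (\<lambda>z. f z * g z)"
proof (induction k arbitrary: f g)
  case 0
  then show ?case by (auto intro: continuous_on_mult)
next
  case (Suc k)
  \<comment> \<open>The product rule leaves one factor undifferentiated; it has to be lowered to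
    order \<open>k\<close> before the induction hypothesis applies.\<close>
  from Suc.prems have "C_class k f" "C_class k g"
    by (blast intro: C_class_Suc_imp)+
  with Suc show ?case
    by (auto simp: partial_x_mult partial_p_mult intro!: C_class_add)
qed

lemma C_class_coordinates: "C_class k fst" "C_class k snd"
proof -
  have "partial_x fst = (\<lambda>z. 1)" "partial_p fst = (\<lambda>z. 0)"
    "partial_x snd = (\<lambda>z. 0)" "partial_p snd = (\<lambda>z. 1)"
    by (auto intro!: partial_x_eqI partial_p_eqI)
  then show "C_class k fst" "C_class k snd"
    by (cases k; auto simp: C_class_const bounded_linear_fst bounded_linear_snd
        intro!: continuous_intros bounded_linear_imp_differentiable_on)+
qed

text \<open>Differentiability and partial derivatives at a point depend only on the germ there, so
  the claim passes to the partial derivatives by induction on \<open>k\<close>. This permits gluing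
  \<open>deep_zeros\<close> from strips.\<close>

lemma C_class_local:
  assumes "\<And>z. \<exists>U g. open U \<and> z \<in> U \<and> C_class k g \<and> (\<forall>w\<in>U. f w = g w)"
  shows "C_class k f"
  using assms
proof (induction k arbitrary: f)
  case 0
  have "isCont f z" for z
  proof -
    obtain U g where *: "open U" "z \<in> U" "C_class 0 g" "\<forall>w\<in>U. f w = g w"
      using 0 by blast
    then have "isCont g z"
      by (cases z) (simp add: continuous_on_eq_continuous_at)
    moreover have "eventually (\<lambda>w. f w = g w) (nhds z)"
      using * by (auto simp: eventually_nhds)
    ultimately show ?thesis
      by (simp add: isCont_cong)
  qed
  then show ?case
    by (simp add: continuous_on_eq_continuous_at)
next
  case (Suc k)
  have "f differentiable at z" for z
  proof -
    obtain U g where *: "open U" "z \<in> U" "C_class (Suc k) g" "\<forall>w\<in>U. f w = g w"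
      using Suc.prems by blast
    then have "g differentiable at z"
      by (cases z) (simp add: differentiable_on_def)
    then obtain g' where "(g has_derivative g') (at z)"
      unfolding differentiable_def by blast
    then have "(f has_derivative g') (at z)"
      by (rule has_derivative_transform_within_open[OF _ *(1,2)]) (use * in auto)
    then show ?thesis
      by (auto simp: differentiable_def)
  qed
  moreover have "\<exists>U g. open U \<and> z \<in> U \<and> C_class k g \<and> (\<forall>w\<in>U. partial_x f w = g w)"
    and "\<exists>U g. open U \<and> z \<in> U \<and> C_class k g \<and> (\<forall>w\<in>U. partial_p f w = g w)" for z
  proof -
    obtain U g where *: "open U" "z \<in> U" "C_class (Suc k) g" "\<forall>w\<in>U. f w = g w"
      using Suc.prems by blast
    have "partial_x f w = partial_x g w \<and> partial_p f w = partial_p g w" if "w \<in> U" for w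
    proof -
      obtain x p where w: "w = (x, p)" by (cases w)
      have "eventually (\<lambda>v. f v = g v) (nhds w)"
        using * that by (auto simp: eventually_nhds)
      then have ev: "eventually (\<lambda>v. f v = g v) (nhds x \<times>\<^sub>F nhds p)"
        by (simp add: w nhds_prod)
      \<comment> \<open>Freezing one coordinate at its centre turns equality near
        \<open>(x, p)\<close> into equality near \<open>x\<close>, respectively near
        \<open>p\<close>, which is all that \<open>deriv\<close> sees.\<close>
      have "eventually (\<lambda>t. f (t, p) = g (t, p)) (nhds x)"
        using eventually_prod_same ev
        by (smt (verit) eventually_mono eventually_nhds_x_imp_x eventually_prod_filter)
      moreover have "eventually (\<lambda>t. f (x, t) = g (x, t)) (nhds p)"
        using ev
        by (smt (verit) eventually_mono eventually_nhds_x_imp_x eventually_prod_filter)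
      ultimately show ?thesis
        by (simp add: w partial_x_def partial_p_def deriv_cong_ev)
    qed
    moreover have "C_class k (partial_x g)" "C_class k (partial_p g)"
      using * by simp_all
    ultimately have px: "open U \<and> z \<in> U \<and> C_class k (partial_x g) \<and> (\<forall>w\<in>U. partial_x f w = partial_x g w)"
      and pp: "open U \<and> z \<in> U \<and> C_class k (partial_p g) \<and> (\<forall>w\<in>U. partial_p f w = partial_p g w)"
      using *(1,2) by metis+
    show "\<exists>U g. open U \<and> z \<in> U \<and> C_class k g \<and> (\<forall>w\<in>U. partial_x f w = g w)"
      by (intro exI) (rule px)
    show "\<exists>U g. open U \<and> z \<in> U \<and> C_class k g \<and> (\<forall>w\<in>U. partial_p f w = g w)"
      by (intro exI) (rule pp)
  qed
  ultimately show ?case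
    unfolding C_class.simps differentiable_on_def by (intro conjI ballI Suc.IH) simp_all
qed

section \<open>The algebra of smooth functions\<close>

lemma smoothD:
  assumes "f \<in> smooth_functions"
  shows smooth_imp_differentiable: "f differentiable_on UNIV"
    and smooth_imp_continuous: "continuous_on UNIV f"
    and smooth_partial_x: "partial_x f \<in> smooth_functions"
    and smooth_partial_p: "partial_p f \<in> smooth_functions"
proof -
  have *: "C_class k f" for k
    using assms by (simp add: smooth_functions_def)
  show "f differentiable_on UNIV"
    using *[of 1] by simp
  show "continuous_on UNIV f"
    using *[of 0] by simp
  have "C_class k (partial_x f) \<and> C_class k (partial_p f)" for k
    using *[of "Suc k"] by simp
  then show "partial_x f \<in> smooth_functions" "partial_p f \<in> smooth_functions"
    by (simp_all add: smooth_functions_def)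
qed

lemma smooth_funpow:
  assumes "f \<in> smooth_functions"
  shows smooth_partial_x_funpow: "(partial_x ^^ k) f \<in> smooth_functions"
    and smooth_partial_p_funpow: "(partial_p ^^ k) f \<in> smooth_functions"
  using assms by (induction k) (auto intro: smooth_partial_x smooth_partial_p)

lemma smooth_const: "(\<lambda>z. c) \<in> smooth_functions"
  by (simp add: smooth_functions_def C_class_const)

lemma smooth_add:
  "f \<in> smooth_functions \<Longrightarrow> g \<in> smooth_functions \<Longrightarrow> (\<lambda>z. f z + g z) \<in> smooth_functions"
  by (simp add: smooth_functions_def C_class_add)

lemma smooth_mult:
  "f \<in> smooth_functions \<Longrightarrow> g \<in> smooth_functions \<Longrightarrow> (\<lambda>z. f z * g z) \<in> smooth_functions"
  by (simp add: smooth_functions_def C_class_mult)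

lemma smooth_diff:
  assumes "f \<in> smooth_functions" "g \<in> smooth_functions"
  shows "(\<lambda>z. f z - g z) \<in> smooth_functions"
  using smooth_add[OF assms(1) smooth_mult[OF smooth_const[of "-1"] assms(2)]] by simp

lemma smooth_power: "f \<in> smooth_functions \<Longrightarrow> (\<lambda>z. f z ^ n) \<in> smooth_functions"
  by (induction n) (auto intro: smooth_mult smooth_const)

lemma smooth_sum:
  "(\<And>i. i \<in> I \<Longrightarrow> f i \<in> smooth_functions) \<Longrightarrow> (\<lambda>z. \<Sum>i\<in>I. f i z) \<in> smooth_functions"
  by (induction I rule: infinite_finite_induct) (auto intro: smooth_add smooth_const)

lemma smooth_coordinates: "fst \<in> smooth_functions" "snd \<in> smooth_functions"
  by (simp_all add: smooth_functions_def C_class_coordinates)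

lemmas smooth_intros = smooth_const smooth_add smooth_mult smooth_diff smooth_power
  smooth_coordinates smooth_partial_x smooth_partial_p

lemma x_powers_smooth: "x_powers \<subseteq> smooth_functions"
proof -
  have "(\<lambda>(x, p). x ^ n) \<in> smooth_functions" for n
    using smooth_power[OF smooth_coordinates(1), of n] by (simp add: case_prod_beta')
  then show ?thesis
    by (auto simp: x_powers_def)
qed

section \<open>Flat functions\<close>

text \<open>The classical flat function \<open>exp (- 1 / u)\<close> divided by
  \<open>u ^ m\<close>. Carrying the negative power as a parameter closes the family under
  differentiation.\<close>

definition flat :: "nat \<Rightarrow> real \<Rightarrow> real" where
  "flat m u = (if u > 0 then (1 / u) ^ m * exp (- (1 / u)) else 0)"

lemma flat_nonpos: "u \<le> 0 \<Longrightarrow> flat m u = 0"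
  by (simp add: flat_def)

lemma flat_Suc: "u * flat (Suc m) u = flat m u"
  by (simp add: flat_def)

lemma flat_0_pos: "u > 0 \<Longrightarrow> flat 0 u > 0"
  by (simp add: flat_def)

text \<open>Substituting \<open>v = 1 / u\<close> on the right of 0 reduces this to the decay of
  \<open>v ^ m / exp v\<close> at infinity.\<close>

lemma flat_tendsto_0: "(flat m \<longlongrightarrow> 0) (at 0)"
proof -
  have "((\<lambda>v. v ^ m / exp v) \<longlongrightarrow> 0) (at_top :: real filter)"
    by (rule tendsto_power_div_exp_0)
  then have "((\<lambda>u. inverse u ^ m / exp (inverse u)) \<longlongrightarrow> 0) (at_right (0::real))"
    by (rule filterlim_compose) (rule filterlim_inverse_at_top_right)
  then have "(flat m \<longlongrightarrow> 0) (at_right 0)"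
    by (rule Lim_transform_eventually)
      (auto simp: eventually_at_right_less flat_def exp_minus field_simps power_one_over
        intro: eventually_mono[OF eventually_at_right_less])
  moreover have "(flat m \<longlongrightarrow> 0) (at_left 0)"
    by (rule tendsto_eventually)
      (auto simp: eventually_at_filter flat_def)
  ultimately show ?thesis
    by (simp add: filterlim_split_at)
qed

lemma has_derivative_flat:
  "(flat m has_real_derivative flat (m + 2) u - real m * flat (m + 1) u) (at u)"
proof -
  consider "u > 0" | "u < 0" | "u = 0" by linarith
  then show ?thesis
  proof cases
    case 1
    have "((\<lambda>u. (1 / u) ^ m * exp (- (1 / u))) has_real_derivative
        flat (m + 2) u - real m * flat (m + 1) u) (at u)"
      using 1
      by (cases m) (auto intro!: derivative_eq_intros
          simp: flat_def field_simps power2_eq_square, metis power_eq_if One_nat_def)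
    then show ?thesis
      by (rule has_field_derivative_transform_within_open[of _ _ _ "{0<..}"])
        (use 1 in \<open>auto simp: flat_def\<close>)
  next
    case 2
    have "((\<lambda>u. 0) has_real_derivative flat (m + 2) u - real m * flat (m + 1) u) (at u)"
      using 2 by (simp add: flat_def)
    then show ?thesis
      by (rule has_field_derivative_transform_within_open[of _ _ _ "{..<0}"])
        (use 2 in \<open>auto simp: flat_def\<close>)
  next
    case 3
    \<comment> \<open>The difference quotient at 0 is \<open>flat (Suc m) h\<close> for nonzero
      \<open>h\<close>.\<close>
    have "((\<lambda>h. flat m h / h) \<longlongrightarrow> 0) (at 0)"
      by (rule Lim_transform_eventually[OF flat_tendsto_0[of "Suc m"]])
        (auto simp: eventually_at_filter flat_def)
    then show ?thesis
      using 3 by (simp add: DERIV_def flat_def)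
  qed
qed

text \<open>Each derivative raises the index of \<open>flat\<close>, hence the induction on
  \<open>k\<close> for arbitrary \<open>m\<close>.\<close>

lemma C_class_flat: "C_class k f \<Longrightarrow> C_class k (\<lambda>z. flat m (f z))"
proof (induction k arbitrary: m)
  case 0
  have "continuous_on UNIV (flat m)"
    by (meson DERIV_isCont continuous_at_imp_continuous_on has_derivative_flat)
  with 0 show ?case
    by (auto intro: continuous_on_compose2)
next
  case (Suc k)
  have f: "C_class k f" "f differentiable_on UNIV"
    using Suc.prems by (auto intro: C_class_Suc_imp)
  have "flat m differentiable_on UNIV"
    using has_derivative_flat
    by (meson differentiable_at_imp_differentiable_on real_differentiable_def)
  then have "(\<lambda>z. flat m (f z)) differentiable_on UNIV"
    using f(2) differentiable_on_compose differentiable_on_subset by blast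
  moreover have "C_class k (\<lambda>z. (flat (m + 2) (f z) - real m * flat (m + 1) (f z)) * g z)"
    if "C_class k g" for g
    using C_class_mult[OF C_class_add[OF Suc.IH[OF f(1)]
        C_class_mult[OF C_class_const[of _ "- real m"] Suc.IH[OF f(1)]]] that]
    by simp
  ultimately show ?case
    using Suc.prems
    by (simp add: partial_x_compose[OF f(2) has_derivative_flat]
        partial_p_compose[OF f(2) has_derivative_flat])
qed

lemma smooth_flat: "f \<in> smooth_functions \<Longrightarrow> (\<lambda>z. flat m (f z)) \<in> smooth_functions"
  by (simp add: smooth_functions_def C_class_flat)

text \<open>Squaring the argument makes \<open>flat m\<close> positive on both signs of \<open>f\<close>.\<close>

definition flat_ideal :: "(real \<times> real \<Rightarrow> real) \<Rightarrow> (real \<times> real \<Rightarrow> real) set" where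
  "flat_ideal f = {\<lambda>z. a z * flat m ((f z)\<^sup>2) | a m. a \<in> smooth_functions}"

lemma flat_idealI: "a \<in> smooth_functions \<Longrightarrow> (\<lambda>z. a z * flat m ((f z)\<^sup>2)) \<in> flat_ideal f"
  by (auto simp: flat_ideal_def)

lemma flat_ideal_smooth:
  "f \<in> smooth_functions \<Longrightarrow> g \<in> flat_ideal f \<Longrightarrow> g \<in> smooth_functions"
  by (auto simp: flat_ideal_def intro!: smooth_intros smooth_flat)

lemma power_mult_flat: "u ^ k * flat (m + k) u = flat m u"
  by (induction k) (auto simp: flat_Suc mult.assoc mult.left_commute[of u])

lemma flat_ideal_const_0: "(\<lambda>z. 0) \<in> flat_ideal f"
  using flat_idealI[OF smooth_const[of 0]] by simp

text \<open>\<open>power_mult_flat\<close> brings both summands to the common index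
  \<open>m + n\<close>; the compensating powers of \<open>f\<close> are smooth.\<close>

lemma flat_ideal_add:
  assumes f: "f \<in> smooth_functions" and "g \<in> flat_ideal f" "h \<in> flat_ideal f"
  shows "(\<lambda>z. g z + h z) \<in> flat_ideal f"
proof -
  obtain a m b n where a: "a \<in> smooth_functions" "g = (\<lambda>z. a z * flat m ((f z)\<^sup>2))"
    and b: "b \<in> smooth_functions" "h = (\<lambda>z. b z * flat n ((f z)\<^sup>2))"
    using assms by (auto simp: flat_ideal_def)
  have "g z + h z = (a z * ((f z)\<^sup>2) ^ n + b z * ((f z)\<^sup>2) ^ m) * flat (m + n) ((f z)\<^sup>2)" for z
    using power_mult_flat[of "(f z)\<^sup>2" n m] power_mult_flat[of "(f z)\<^sup>2" m n]
    by (simp add: a b algebra_simps)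
  then have "(\<lambda>z. g z + h z) =
      (\<lambda>z. (a z * ((f z)\<^sup>2) ^ n + b z * ((f z)\<^sup>2) ^ m) * flat (m + n) ((f z)\<^sup>2))"
    by (rule ext)
  moreover have "(\<lambda>z. a z * ((f z)\<^sup>2) ^ n + b z * ((f z)\<^sup>2) ^ m) \<in> smooth_functions"
    by (intro smooth_intros f a b)
  ultimately show ?thesis
    by (simp only: flat_idealI)
qed

lemma flat_ideal_mult:
  assumes "g \<in> flat_ideal f" "h \<in> smooth_functions"
  shows "(\<lambda>z. h z * g z) \<in> flat_ideal f"
proof -
  obtain a m where a: "a \<in> smooth_functions" "g = (\<lambda>z. a z * flat m ((f z)\<^sup>2))"
    using assms by (auto simp: flat_ideal_def)
  have "(\<lambda>z. h z * g z) = (\<lambda>z. (h z * a z) * flat m ((f z)\<^sup>2))"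
    by (simp add: a mult.assoc)
  with flat_idealI[OF smooth_mult[OF assms(2) a(1)]] show ?thesis
    by simp
qed

lemma flat_ideal_sum:
  assumes "f \<in> smooth_functions" "\<And>i. i \<in> I \<Longrightarrow> g i \<in> flat_ideal f"
  shows "(\<lambda>z. \<Sum>i\<in>I. g i z) \<in> flat_ideal f"
  using assms(2)
  by (induction I rule: infinite_finite_induct)
    (auto intro: flat_ideal_const_0 flat_ideal_add[OF assms(1)])

text \<open>Raising the index by one gains a factor \<open>1 / f\<^sup>2\<close>, of which one half
  performs the division and the other is cancelled by the extra \<open>f\<close> in the coefficient.
  On the zeros of \<open>f\<close> both sides vanish.\<close>

lemma flat_ideal_divide:
  assumes f: "f \<in> smooth_functions" and "g \<in> flat_ideal f"
  shows "\<exists>h\<in>flat_ideal f. \<forall>z. f z * h z = g z"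
proof -
  obtain a m where a: "a \<in> smooth_functions" "g = (\<lambda>z. a z * flat m ((f z)\<^sup>2))"
    using assms by (auto simp: flat_ideal_def)
  have "(\<lambda>z. (a z * f z) * flat (Suc m) ((f z)\<^sup>2)) \<in> flat_ideal f"
    by (rule flat_idealI[OF smooth_mult[OF a(1) f]])
  moreover have "f z * ((a z * f z) * flat (Suc m) ((f z)\<^sup>2)) = g z" for z
    using flat_Suc[of "(f z)\<^sup>2" m] by (simp add: a power2_eq_square algebra_simps)
  ultimately show ?thesis
    by (intro bexI[of _ "\<lambda>z. (a z * f z) * flat (Suc m) ((f z)\<^sup>2)"]) auto
qed

lemma flat_ideal_partial_x:
  assumes f: "f \<in> smooth_functions" and "g \<in> flat_ideal f"
  shows "partial_x g \<in> flat_ideal f"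
proof -
  obtain a m where a: "a \<in> smooth_functions" "g = (\<lambda>z. a z * flat m ((f z)\<^sup>2))"
    using assms by (auto simp: flat_ideal_def)
  define v where "v = (\<lambda>z. (f z)\<^sup>2)"
  have v: "v \<in> smooth_functions"
    unfolding v_def by (intro smooth_intros f)
  have g: "g = (\<lambda>z. a z * flat m (v z))"
    by (simp add: a v_def)
  \<comment> \<open>The coefficient left after writing \<open>flat m\<close> and
    \<open>flat (m + 1)\<close> as multiples of \<open>flat (m + 2)\<close>.\<close>
  define b where "b = (\<lambda>z. a z * (1 - real m * v z) * partial_x v z + partial_x a z * v z ^ 2)"
  have "partial_x g = (\<lambda>z. a z * ((flat (m + 2) (v z) - real m * flat (m + 1) (v z)) * partial_x v z)
      + partial_x a z * flat m (v z))"
    unfolding g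
    by (subst partial_x_mult)
      (use a v in \<open>auto intro!: smooth_imp_differentiable smooth_flat
        simp: partial_x_compose[OF smooth_imp_differentiable[OF v] has_derivative_flat]\<close>)
  also have "\<dots> = (\<lambda>z. b z * flat (m + 2) (v z))"
  proof
    fix z
    have "flat m (v z) = v z ^ 2 * flat (m + 2) (v z)"
      and "flat (m + 1) (v z) = v z * flat (m + 2) (v z)"
      using power_mult_flat[of "v z" 2 m] flat_Suc[of "v z" "m + 1"] by simp_all
    then show "a z * ((flat (m + 2) (v z) - real m * flat (m + 1) (v z)) * partial_x v z)
        + partial_x a z * flat m (v z) = b z * flat (m + 2) (v z)"
      by (simp only: b_def) (simp add: algebra_simps)
  qed
  finally have "partial_x g = (\<lambda>z. b z * flat (m + 2) ((f z)\<^sup>2))"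
    by (simp add: v_def)
  moreover have "b \<in> smooth_functions"
    unfolding b_def by (intro smooth_intros v a)
  ultimately show ?thesis
    by (simp only: flat_idealI)
qed

lemma flat_ideal_partial_x_funpow:
  "f \<in> smooth_functions \<Longrightarrow> g \<in> flat_ideal f \<Longrightarrow> (partial_x ^^ k) g \<in> flat_ideal f"
  by (induction k) (auto intro: flat_ideal_partial_x)

section \<open>The star product\<close>

lemma star_nth:
  "fps_nth (star F G) n z = (\<Sum>(k, i, j) \<in> {(k, i, j). k + i + j = n}.
     1 / fact k * (partial_p ^^ k) (fps_nth F i) z * (partial_x ^^ k) (fps_nth G j) z)"
  by (simp add: star_def)

lemma star_nth_0: "fps_nth (star F G) 0 z = fps_nth F 0 z * fps_nth G 0 z"
proof -
  have "{(k, i, j). k + i + j = (0::nat)} = {(0, 0, 0)}"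
    by auto
  then show ?thesis
    by (simp add: star_nth)
qed

definition lower_index :: "nat \<Rightarrow> (nat \<times> nat \<times> nat) set" where
  "lower_index n = {(k, i, j). k + i + j = n \<and> j < n}"

text \<open>The triple \<open>(0, 0, n)\<close> is the only one that involves the coefficient of
  \<open>G\<close> of degree \<open>n\<close>. Thus star multiplication by \<open>F\<close> from the
  left is triangular, with \<open>fps_nth F 0\<close> on the diagonal.\<close>

lemma star_nth_split:
  "fps_nth (star F G) n z = fps_nth F 0 z * fps_nth G n z + (\<Sum>(k, i, j) \<in> lower_index n.
     1 / fact k * (partial_p ^^ k) (fps_nth F i) z * (partial_x ^^ k) (fps_nth G j) z)"
proof -
  have "{(k, i, j). k + i + j = n} = insert (0, 0, n) (lower_index n)"
    by (auto simp: lower_index_def)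
  moreover have "finite (lower_index n)"
    by (rule finite_subset[OF _ finite_star_index[of n]]) (auto simp: lower_index_def)
  moreover have "(0, 0, n) \<notin> lower_index n"
    by (simp add: lower_index_def)
  ultimately show ?thesis
    by (simp add: star_nth)
qed

section \<open>Series with smooth coefficients and the sets \<open>plus_lambda T\<close>\<close>

lemma carrier_star_algebra:
  "F \<in> carrier star_algebra \<longleftrightarrow> (\<forall>n. fps_nth F n \<in> smooth_functions)"
  by (simp add: star_algebra_def)

lemma star_algebra_simps [simp]:
  "mult star_algebra = star" "one star_algebra = 1" "zero star_algebra = 0"
  by (simp_all add: star_algebra_def)

lemma star_closed:
  assumes "F \<in> carrier star_algebra" "G \<in> carrier star_algebra"
  shows "star F G \<in> carrier star_algebra"
proof -
  have "fps_nth (star F G) n \<in> smooth_functions" for n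
    unfolding star_def fps_nth_Abs_fps case_prod_beta
    by (intro smooth_sum smooth_intros smooth_partial_x_funpow smooth_partial_p_funpow)
      (use assms in \<open>simp_all add: carrier_star_algebra\<close>)
  then show ?thesis
    by (simp add: carrier_star_algebra)
qed

lemma one_in_carrier: "1 \<in> carrier star_algebra"
  using smooth_const[of 1] smooth_const[of 0]
  by (auto simp: carrier_star_algebra fps_one_nth zero_fun_def one_fun_def)

lemma fps_const_in_carrier:
  "f \<in> smooth_functions \<Longrightarrow> fps_const f \<in> carrier star_algebra"
  using smooth_const[of 0]
  by (auto simp: carrier_star_algebra zero_fun_def)

text \<open>A series is its constant coefficient plus \<open>fps_X\<close> times its shift, so
  beyond the carrier condition only the constant coefficient matters.\<close>

lemma mem_plus_lambda_iff:
  assumes "T \<subseteq> smooth_functions"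
  shows "F \<in> plus_lambda T \<longleftrightarrow> F \<in> carrier star_algebra \<and> fps_nth F 0 \<in> T"
proof
  assume "F \<in> plus_lambda T"
  then obtain f G where *: "F = fps_const f + fps_X * G" "f \<in> T" "G \<in> carrier star_algebra"
    by (auto simp: plus_lambda_def)
  have "fps_nth F n \<in> smooth_functions" for n
    using * assms by (cases n) (auto simp: carrier_star_algebra)
  with * show "F \<in> carrier star_algebra \<and> fps_nth F 0 \<in> T"
    by (simp add: carrier_star_algebra)
next
  assume *: "F \<in> carrier star_algebra \<and> fps_nth F 0 \<in> T"
  have "F = fps_const (fps_nth F 0) + fps_X * fps_shift 1 F"
    by (rule fps_ext) (simp add: fps_X_mult_nth)
  moreover have "fps_shift 1 F \<in> carrier star_algebra"
    using * by (simp add: carrier_star_algebra)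
  ultimately show "F \<in> plus_lambda T"
    using * unfolding plus_lambda_def by blast
qed

lemma partial_funpow_0 [simp]:
  "(partial_x ^^ k) (\<lambda>z. 0) = (\<lambda>z. 0)" "(partial_p ^^ k) (\<lambda>z. 0) = (\<lambda>z. 0)"
  by (induction k) auto

lemma partial_funpow_zero [simp]: "(partial_x ^^ k) 0 = 0" "(partial_p ^^ k) 0 = 0"
  by (simp_all add: zero_fun_def)

lemma star_0_left: "star 0 F = 0"
  by (rule fps_ext) (auto simp: star_nth fun_eq_iff zero_fun_def intro!: sum.neutral)

lemma multiplicative_subset_plus_lambda:
  assumes T: "T \<subseteq> smooth_functions" and one: "1 \<in> T"
    and mult: "\<And>f g. f \<in> T \<Longrightarrow> g \<in> T \<Longrightarrow> f * g \<in> T"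
  shows "multiplicative_subset star_algebra (plus_lambda T)"
proof -
  have "fps_nth (star F G) 0 = fps_nth F 0 * fps_nth G 0" for F G
    by (auto simp: fun_eq_iff star_nth_0)
  then show ?thesis
    using one one_in_carrier mult star_closed
    by (auto simp: multiplicative_subset_def mem_plus_lambda_iff[OF T])
qed


section \<open>Right denominator sets from nonvanishing on a dense set\<close>

text \<open>By \<open>star_nth_split\<close> the equation asks to divide, degree by degree, an
  expression in the earlier coefficients of \<open>r'\<close> by \<open>f\<close>. All these
  expressions stay in \<open>flat_ideal f\<close>, where division is possible.\<close>

lemma right_denominator_equation:
  assumes r: "r \<in> carrier star_algebra" and s: "s \<in> carrier star_algebra"
  shows "\<exists>r'\<in>carrier star_algebra.
    star r (fps_const (\<lambda>z. flat 0 ((fps_nth s 0 z)\<^sup>2))) = star s r'"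
proof -
  define f where "f = fps_nth s 0"
  define t where "t = star r (fps_const (\<lambda>z. flat 0 ((f z)\<^sup>2)))"
  have f: "f \<in> smooth_functions"
    using s by (simp add: f_def carrier_star_algebra)
  have "(\<lambda>z. flat 0 ((f z)\<^sup>2)) \<in> flat_ideal f"
    using flat_idealI[OF smooth_const[of 1]] by simp
  then have g: "fps_nth (fps_const (\<lambda>z. flat 0 ((f z)\<^sup>2))) j \<in> flat_ideal f" for j
    using flat_ideal_const_0[of f] by (simp add: zero_fun_def)
  have t: "fps_nth t n \<in> flat_ideal f" for n
    unfolding t_def star_def fps_nth_Abs_fps case_prod_beta
    by (intro flat_ideal_sum f flat_ideal_mult smooth_intros smooth_partial_p_funpow
        flat_ideal_partial_x_funpow g) (use r in \<open>simp add: carrier_star_algebra\<close>)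
  define c where "c = (\<lambda>h n z. \<Sum>(k, i, j) \<in> lower_index n.
    1 / fact k * (partial_p ^^ k) (fps_nth s i) z * (partial_x ^^ k) (h j) z)"
  define P where "P = (\<lambda>h n y. y \<in> flat_ideal f \<and> (\<forall>z. f z * y z = fps_nth t n z - c h n z))"
  have c_cong: "c h n = c h' n" if "\<And>j. j < n \<Longrightarrow> h j = h' j" for h h' n
    unfolding c_def using that by (auto simp: lower_index_def intro!: sum.cong)
  \<comment> \<open>Division only asserts existence and every coefficient depends on the earlier
    choices, so the sequence comes from dependent choice along \<open><\<close>.\<close>
  have "\<exists>h. \<forall>n. P h n (h n)"
  proof (rule dependent_wf_choice[of "{(j, n). j < n}"])
    show "wf {(j :: nat, n). j < n}"
      by (rule wf)
    show "P h n y = P h' n y" if "\<And>j. (j, n) \<in> {(j, n). j < n} \<Longrightarrow> h j = h' j" for h h' n y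
      using c_cong[of n h h'] that by (simp add: P_def)
    show "\<exists>y. P h n y" if "\<And>j. (j, n) \<in> {(j, n). j < n} \<Longrightarrow> P h j (h j)" for n h
    proof -
      have "c h n \<in> flat_ideal f"
        unfolding c_def case_prod_beta
        by (intro flat_ideal_sum f flat_ideal_mult smooth_intros smooth_partial_p_funpow
            flat_ideal_partial_x_funpow)
          (use s that in \<open>auto simp: carrier_star_algebra lower_index_def P_def\<close>)
      from flat_ideal_add[OF f t[of n] flat_ideal_mult[OF this smooth_const[of "-1"]]]
      have "(\<lambda>z. fps_nth t n z - c h n z) \<in> flat_ideal f"
        by simp
      from flat_ideal_divide[OF f this] show ?thesis
        unfolding P_def by blast
    qed
  qed
  then obtain h where h: "\<And>n. P h n (h n)"
    by blast
  have "h n \<in> smooth_functions" for n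
    using h[of n] flat_ideal_smooth[OF f] by (simp add: P_def)
  then have "Abs_fps h \<in> carrier star_algebra"
    by (simp add: carrier_star_algebra)
  moreover have "t = star s (Abs_fps h)"
  proof (rule fps_ext, rule ext)
    fix n z
    have "f z * h n z = fps_nth t n z - c h n z"
      using h[of n] unfolding P_def by blast
    then show "fps_nth t n z = fps_nth (star s (Abs_fps h)) n z"
      by (simp add: star_nth_split c_def f_def)
  qed
  ultimately show ?thesis
    unfolding t_def f_def by blast
qed

text \<open>Once the lower coefficients of \<open>r\<close> vanish, the triangular form leaves
  \<open>fps_nth s 0 z * fps_nth r n z = 0\<close>. So the next coefficient vanishes on
  \<open>U\<close>, and everywhere by continuity and density.\<close>

lemma star_left_cancel_zero:
  assumes r: "r \<in> carrier star_algebra" and U: "closure U = UNIV"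
    and s: "\<And>y. y \<in> U \<Longrightarrow> fps_nth s 0 y \<noteq> 0" and eq: "star s r = 0"
  shows "r = 0"
proof -
  have "fps_nth r n = 0" for n
  proof (induction n rule: less_induct)
    case (less n)
    have "fps_nth s 0 z * fps_nth r n z = 0" for z
    proof -
      have "(\<Sum>(k, i, j) \<in> lower_index n.
          1 / fact k * (partial_p ^^ k) (fps_nth s i) z * (partial_x ^^ k) (fps_nth r j) z) = 0"
        using less by (auto simp: lower_index_def intro!: sum.neutral)
      then show ?thesis
        using star_nth_split[of s r n z] by (simp add: eq)
    qed
    then have "\<And>y. y \<in> U \<Longrightarrow> fps_nth r n y = 0"
      using s by fastforce
    moreover have "continuous_on (closure U) (fps_nth r n)"
      using r by (simp add: U carrier_star_algebra smooth_imp_continuous)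
    ultimately have "fps_nth r n z = 0" for z
      using continuous_constant_on_closure[of U "fps_nth r n" 0 z] U by simp
    then show ?case
      by (simp add: fun_eq_iff)
  qed
  then show ?thesis
    by (simp add: fps_eq_iff)
qed

lemma closure_minus_zero: "closure (- {0::real}) = UNIV"
  by (simp add: closure_complement)

lemma closure_Omega: "closure \<Omega> = UNIV"
proof -
  have *: "\<Omega> = (- {0}) \<times> UNIV"
    by (auto simp: \<Omega>_def)
  show ?thesis
    unfolding * closure_Times closure_minus_zero by simp
qed

lemma nonvanishing_on_smooth: "nonvanishing_on U \<subseteq> smooth_functions"
  by (auto simp: nonvanishing_on_def)

lemma right_denominator_set_nonvanishing:
  assumes U: "closure U = UNIV"
  shows "right_denominator_set star_algebra (plus_lambda (nonvanishing_on U))"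
proof -
  let ?T = "plus_lambda (nonvanishing_on U)"
  note mem = mem_plus_lambda_iff[OF nonvanishing_on_smooth]
  have mult: "multiplicative_subset star_algebra ?T"
    using smooth_const[of 1]
    by (intro multiplicative_subset_plus_lambda nonvanishing_on_smooth)
      (auto simp: nonvanishing_on_def one_fun_def times_fun_def intro: smooth_mult)
  have "\<exists>r'\<in>carrier star_algebra. \<exists>s'\<in>?T. star r s' = star s r'"
    if "r \<in> carrier star_algebra" "s \<in> ?T" for r s
  proof -
    let ?g = "\<lambda>z. flat 0 ((fps_nth s 0 z)\<^sup>2)"
    have s: "s \<in> carrier star_algebra" "fps_nth s 0 \<in> nonvanishing_on U"
      using that by (auto simp: mem)
    have g: "?g \<in> smooth_functions"
      using s by (intro smooth_flat smooth_intros) (simp add: carrier_star_algebra)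
    \<comment> \<open>The argument of \<open>flat 0\<close> is the square of a nonzero number, and
      \<open>flat 0\<close> is positive on positive arguments.\<close>
    have "?g y \<noteq> 0" if "y \<in> U" for y
      using flat_0_pos[of "(fps_nth s 0 y)\<^sup>2"] s(2) that by (auto simp: nonvanishing_on_def)
    with g have "?g \<in> nonvanishing_on U"
      by (simp add: nonvanishing_on_def)
    with g have "fps_const ?g \<in> ?T"
      by (simp add: mem fps_const_in_carrier)
    with right_denominator_equation[OF that(1) s(1)] show ?thesis
      by blast
  qed
  moreover have "\<exists>s\<in>?T. star r s = 0"
    if "r \<in> carrier star_algebra" "s' \<in> ?T" "star s' r = 0" for r s'
  proof -
    have "fps_nth s' 0 \<in> nonvanishing_on U"
      using that(2) by (simp add: mem)
    then have "r = 0"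
      by (intro star_left_cancel_zero[OF that(1) U _ that(3)]) (simp add: nonvanishing_on_def)
    then show ?thesis
      using mult by (auto simp: multiplicative_subset_def star_0_left)
  qed
  ultimately show ?thesis
    using mult by (simp add: right_denominator_set_def right_Ore_def right_reversible_def)
qed

section \<open>Failure of the Ore conditions\<close>

text \<open>The constant \<open>1 / 16\<close> confines the support to distance \<open>1 / 4\<close>
  from \<open>n\<close>, away from the half-integers where \<open>round\<close> jumps.\<close>

definition bump :: "int \<Rightarrow> real \<Rightarrow> real" where
  "bump n p = flat 0 (1 / 16 - (p - of_int n)\<^sup>2)"

text \<open>A function of \<open>p\<close> alone which vanishes at each \<open>m \<in> \<nat>\<close> to order exactly \<open>m\<close>.\<close>

definition deep_zeros :: "real \<times> real \<Rightarrow> real" where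
  "deep_zeros z = (let n = round (snd z) in (snd z - of_int n) ^ nat n * bump n (snd z))"

lemma bump_smooth: "(\<lambda>z. bump n (snd z)) \<in> smooth_functions"
  unfolding bump_def by (intro smooth_flat smooth_intros)

lemma bump_eq_0: "1 / 4 \<le> \<bar>p - of_int n\<bar> \<Longrightarrow> bump n p = 0"
  using power_mono[of "1/4" "\<bar>p - of_int n\<bar>" 2]
  by (auto simp: bump_def power_divide intro!: flat_nonpos)

lemma bump_center: "bump n (of_int n) > 0"
  by (simp add: bump_def flat_0_pos)

text \<open>Where \<open>round p\<close> differs from \<open>n\<close>, both bumps vanish:
  \<open>p\<close> is at least \<open>1 / 2\<close> away from \<open>n\<close> and at least
  \<open>1 / 4\<close> from \<open>round p\<close>. As \<open>3 / 4 > 1 / 2\<close>, these open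
  strips cover the plane.\<close>

lemma deep_zeros_near_int:
  assumes "\<bar>p - of_int n\<bar> < 3 / 4"
  shows "deep_zeros (x, p) = (p - of_int n) ^ nat n * bump n p"
proof (cases "round p = n")
  case True
  then show ?thesis
    by (simp add: deep_zeros_def)
next
  case False
  then have "1 / 2 \<le> \<bar>p - of_int n\<bar>"
    using round_unique'[of p n] by force
  then have "bump n p = 0"
    by (intro bump_eq_0) simp
  moreover have "1 / 4 \<le> \<bar>p - of_int (round p)\<bar>"
  proof -
    have "1 \<le> \<bar>round p - n\<bar>"
      using False by simp
    then have "1 \<le> \<bar>of_int (round p) - of_int n :: real\<bar>"
      by (metis of_int_1_le_iff of_int_abs of_int_diff)
    with assms show ?thesis
      by linarith
  qed
  ultimately show ?thesis
    by (simp add: deep_zeros_def Let_def bump_eq_0)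
qed

lemma deep_zeros_smooth: "deep_zeros \<in> smooth_functions"
proof -
  have "C_class k deep_zeros" for k
  proof (rule C_class_local)
    fix z :: "real \<times> real"
    define n where "n = round (snd z)"
    define U where "U = {w :: real \<times> real. \<bar>snd w - of_int n\<bar> < 3 / 4}"
    have "open U"
      unfolding U_def by (intro open_Collect_less continuous_intros)
    moreover have "z \<in> U"
      using of_int_round_abs_le[of "snd z"] by (simp add: U_def n_def abs_minus_commute)
    moreover have "(\<lambda>w. (snd w - of_int n) ^ nat n * bump n (snd w)) \<in> smooth_functions"
      by (intro smooth_intros bump_smooth)
    moreover have "\<forall>w\<in>U. deep_zeros w = (snd w - of_int n) ^ nat n * bump n (snd w)"
      using deep_zeros_near_int[of _ n] by (auto simp: U_def)
    ultimately show "\<exists>U g. open U \<and> z \<in> U \<and> C_class k g \<and> (\<forall>w\<in>U. deep_zeros w = g w)"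
      unfolding smooth_functions_def by blast
  qed
  then show ?thesis
    by (simp add: smooth_functions_def)
qed

section \<open>Derivatives at zeros of finite order\<close>

lemma partial_x_deep_zeros: "partial_x deep_zeros = (\<lambda>z. 0)"
  by (rule partial_x_eqI) (simp add: deep_zeros_def)

text \<open>The product rule: one differentiation lowers the order of the zero by one and multiplies
  the quotient on \<open>p = c\<close> by the old order.\<close>

lemma partial_p_strip:
  assumes g: "g \<in> smooth_functions"
    and f: "\<And>x p. \<bar>p - c\<bar> < e \<Longrightarrow> f (x, p) = (p - c) ^ Suc k * g (x, p)"
    and p: "\<bar>p - c\<bar> < e"
  shows "partial_p f (x, p) = (p - c) ^ k * (real (Suc k) * g (x, p) + (p - c) * partial_p g (x, p))"
proof -
  have "((\<lambda>t. (t - c) ^ Suc k * g (x, t)) has_real_derivative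
      (p - c) ^ k * (real (Suc k) * g (x, p) + (p - c) * partial_p g (x, p))) (at p)"
    by (rule derivative_eq_intros has_derivative_partial_p smooth_imp_differentiable g refl)+
      (simp add: algebra_simps)
  then have "((\<lambda>t. f (x, t)) has_real_derivative
      (p - c) ^ k * (real (Suc k) * g (x, p) + (p - c) * partial_p g (x, p))) (at p)"
    by (rule has_field_derivative_transform_within_open[of _ _ _ "{c - e<..<c + e}"])
      (use p f in \<open>auto simp: abs_less_iff\<close>)
  then show ?thesis
    by (simp add: partial_p_def DERIV_imp_deriv)
qed

lemma partial_p_funpow_zero_order:
  assumes "g \<in> smooth_functions" "e > 0" "k \<le> m"
    and "\<And>x p. \<bar>p - c\<bar> < e \<Longrightarrow> f (x, p) = (p - c) ^ m * g (x, p)"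
  shows "(partial_p ^^ k) f (x, c) = (if k = m then fact m * g (x, c) else 0)"
  using assms
proof (induction m arbitrary: f g k)
  case 0
  then show ?case by simp
next
  case (Suc m)
  show ?case
  proof (cases k)
    case 0
    then show ?thesis using Suc.prems(2,4) by simp
  next
    case (Suc l)
    \<comment> \<open>The quotient of \<open>partial_p f\<close> by \<open>(p - c) ^ m\<close>; on
      \<open>p = c\<close> only its first summand survives, which builds up the factorial.\<close>
    let ?h = "\<lambda>z. real (Suc m) * g z + (snd z - c) * partial_p g z"
    have "?h \<in> smooth_functions"
      by (intro smooth_intros Suc.prems)
    moreover have "partial_p f (x, p) = (p - c) ^ m * ?h (x, p)" if "\<bar>p - c\<bar> < e" for x p
      using partial_p_strip[OF Suc.prems(1,4) that] by simp
    ultimately have "(partial_p ^^ l) (partial_p f) (x, c) = (if l = m then fact m * ?h (x, c) else 0)"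
      using Suc.prems(2,3) Suc by (intro Suc.IH) auto
    then show ?thesis
      by (simp add: Suc funpow_Suc_right del: funpow.simps)
  qed
qed

text \<open>The scalar \<open>a\<close> absorbs the factor \<open>Suc k\<close> released by each
  derivative in the induction.\<close>

lemma partial_x_funpow_power:
  "(partial_x ^^ k) (\<lambda>z. a * fst z ^ k) = (\<lambda>z. a * fact k)"
proof (induction k arbitrary: a)
  case 0
  then show ?case by simp
next
  case (Suc k)
  have "partial_x (\<lambda>z. a * fst z ^ Suc k) = (\<lambda>z. (a * real (Suc k)) * fst z ^ k)"
  proof (rule partial_x_eqI)
    fix x p :: real
    show "((\<lambda>t. a * fst (t, p) ^ Suc k) has_real_derivative a * real (Suc k) * fst (x, p) ^ k) (at x)"
      using DERIV_cmult[OF DERIV_pow[of "Suc k" x], of a] by (simp add: mult.assoc)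
  qed
  then show ?case
    using Suc[of "a * real (Suc k)"]
    by (simp add: funpow_Suc_right algebra_simps del: funpow.simps)
qed

section \<open>Star products with \<open>x\<close> and with functions of \<open>p\<close>\<close>

lemma partial_coordinates:
  "partial_x fst = (\<lambda>z. 1)" "partial_p fst = (\<lambda>z. 0)"
  by (auto intro!: partial_x_eqI partial_p_eqI)

text \<open>The left factor is free of \<open>p\<close>, so only the terms with \<open>k = 0\<close>
  survive.\<close>

lemma star_fst_left: "fps_nth (star (fps_const fst) F) n z = fst z * fps_nth F n z"
proof -
  have "(partial_p ^^ k) (fps_nth (fps_const fst) i) z = 0" if "k + i > 0" for k i
    using that by (cases i; cases k)
      (auto simp: funpow_Suc_right partial_coordinates simp del: funpow.simps)
  then have "(\<Sum>(k, i, j) \<in> lower_index n. 1 / fact k *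
      (partial_p ^^ k) (fps_nth (fps_const fst) i) z * (partial_x ^^ k) (fps_nth F j) z) = 0"
    by (intro sum.neutral) (auto simp: lower_index_def simp del: fps_nth_fps_const)
  then show ?thesis
    by (simp add: star_nth_split)
qed

lemma star_const_right:
  assumes "partial_x g = (\<lambda>z. 0)"
  shows "fps_nth (star F (fps_const g)) n z = fps_nth F n z * g z"
proof -
  have zero: "(partial_x ^^ k) (fps_nth (fps_const g) j) z = 0"
    if "k + i + j = n" "(k, i, j) \<noteq> (0, n, 0)" for k i j
    using that assms by (cases j; cases k) (auto simp: funpow_Suc_right simp del: funpow.simps)
  have "fps_nth (star F (fps_const g)) n z = (\<Sum>(k, i, j) \<in> {(0, n, 0)}.
      1 / fact k * (partial_p ^^ k) (fps_nth F i) z * (partial_x ^^ k) (fps_nth (fps_const g) j) z)"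
    unfolding star_nth
    by (rule sum.mono_neutral_right[OF finite_star_index]) (use zero in fastforce)+
  then show ?thesis
    by simp
qed

text \<open>Only \<open>k = 0\<close> and \<open>k = 1\<close> survive, since second and higher
  derivatives of \<open>x\<close> vanish; the term \<open>k = 1\<close> takes its coefficient one
  degree lower.\<close>

lemma star_fst_right:
  "fps_nth (star F (fps_const fst)) (Suc n) z =
    fst z * fps_nth F (Suc n) z + partial_p (fps_nth F n) z"
proof -
  have zero: "(partial_x ^^ k) (fps_nth (fps_const fst) j) z = 0" if "k > 1 \<or> j \<noteq> 0" for k j
    using that by (cases j; cases k; cases "k - 1")
      (auto simp: funpow_Suc_right partial_coordinates simp del: funpow.simps)
  have "fps_nth (star F (fps_const fst)) (Suc n) z =
      (\<Sum>(k, i, j) \<in> {(0, Suc n, 0), (1, n, 0)}. 1 / fact k *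
        (partial_p ^^ k) (fps_nth F i) z * (partial_x ^^ k) (fps_nth (fps_const fst) j) z)"
    unfolding star_nth
  proof (rule sum.mono_neutral_right[OF finite_star_index])
    show "\<forall>a\<in>{(k, i, j). k + i + j = Suc n} - {(0, Suc n, 0), (1, n, 0)}.
        (case a of (k, i, j) \<Rightarrow> 1 / fact k * (partial_p ^^ k) (fps_nth F i) z *
          (partial_x ^^ k) (fps_nth (fps_const fst) j) z) = 0"
    proof
      fix a :: "nat \<times> nat \<times> nat"
      assume a: "a \<in> {(k, i, j). k + i + j = Suc n} - {(0, Suc n, 0), (1, n, 0)}"
      obtain k i j where kij: "a = (k, i, j)"
        by (cases a)
      have "k > 1 \<or> j \<noteq> 0"
        using a unfolding kij by (cases k) auto
      from zero[OF this] show "(case a of (k, i, j) \<Rightarrow> 1 / fact k *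
          (partial_p ^^ k) (fps_nth F i) z * (partial_x ^^ k) (fps_nth (fps_const fst) j) z) = 0"
        by (simp add: kij)
    qed
  qed auto
  then show ?thesis
    by (simp add: partial_coordinates)
qed

section \<open>The obstructions to both Ore conditions\<close>

lemma fst_in_plus_lambda: "fps_const fst \<in> plus_lambda x_powers"
proof -
  have "fst = (\<lambda>(x, p). x ^ 1 :: real)"
    by auto
  then have "fst \<in> x_powers"
    unfolding x_powers_def by blast
  then show ?thesis
    using x_powers_smooth
    by (auto simp: mem_plus_lambda_iff[OF x_powers_smooth] intro: fps_const_in_carrier)
qed

lemma plus_lambda_x_powersE:
  assumes "s \<in> plus_lambda x_powers"
  obtains m where "fps_nth s 0 = (\<lambda>z. fst z ^ m)" "s \<in> carrier star_algebra"
  using assms unfolding mem_plus_lambda_iff[OF x_powers_smooth]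
  by (auto simp: x_powers_def case_prod_beta')

lemma star_deep_zeros_not_divisible:
  assumes "s \<in> plus_lambda x_powers"
  shows "star (fps_const deep_zeros) s \<noteq> star (fps_const fst) r"
proof
  assume eq: "star (fps_const deep_zeros) s = star (fps_const fst) r"
  obtain m where m: "fps_nth s 0 = (\<lambda>z. fst z ^ m)"
    using assms(1) by (rule plus_lambda_x_powersE)
  let ?z = "(0, real m)"
  have deep: "(partial_p ^^ k) deep_zeros ?z = (if k = m then fact m * bump (int m) (real m) else 0)"
    if "k \<le> m" for k
    using partial_p_funpow_zero_order[OF bump_smooth[of "int m"] _ that, of "1 / 2" "real m" deep_zeros 0]
      deep_zeros_near_int[of _ "int m"] by auto
  \<comment> \<open>For \<open>i > 0\<close> the coefficient of the left factor is zero; for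
    \<open>i = 0\<close> and \<open>k < m\<close> the order of the zero at \<open>p = m\<close> is
    too high.\<close>
  have zero: "(partial_p ^^ k) (fps_nth (fps_const deep_zeros) i) ?z = 0"
    if "k + i + j = m" "(k, i, j) \<noteq> (m, 0, 0)" for k i j
    using that deep[of k] by (cases i) auto
  have "fps_nth (star (fps_const deep_zeros) s) m ?z = (\<Sum>(k, i, j) \<in> {(m, 0, 0)}. 1 / fact k *
      (partial_p ^^ k) (fps_nth (fps_const deep_zeros) i) ?z * (partial_x ^^ k) (fps_nth s j) ?z)"
    unfolding star_nth
    by (rule sum.mono_neutral_right[OF finite_star_index]) (use zero in fastforce)+
  also have "\<dots> = fact m * bump (int m) (real m)"
    using partial_x_funpow_power[of m 1] by (simp add: m deep)
  \<comment> \<open>By \<open>star_fst_left\<close> the other side carries a factor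
    \<open>x\<close>, which is 0 at \<open>?z\<close>.\<close>
  finally have "fact m * bump (int m) (real m) = 0"
    by (simp add: eq star_fst_left)
  then show False
    using bump_center[of "int m"] by simp
qed

lemma fst_star_deep_zeros_not_divisible:
  assumes "s \<in> plus_lambda x_powers" and r: "r \<in> carrier star_algebra"
  shows "star s (fps_const deep_zeros) \<noteq> star r (fps_const fst)"
proof
  assume eq: "star s (fps_const deep_zeros) = star r (fps_const fst)"
  obtain m where m: "fps_nth s 0 = (\<lambda>z. fst z ^ m)" and s: "s \<in> carrier star_algebra"
    using assms(1) by (rule plus_lambda_x_powersE)
  define c where "c = real m"
  define b where "b = bump (int m)"
  have b: "(\<lambda>z. b (snd z)) \<in> smooth_functions" "b c > 0"
    using bump_smooth[of "int m"] bump_center[of "int m"] by (simp_all add: b_def c_def)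
  have deep: "deep_zeros (x, p) = (p - c) ^ m * b p" if "\<bar>p - c\<bar> < 1 / 2" for x p
    using deep_zeros_near_int[of p "int m" x] that by (simp add: b_def c_def)
  have r_smooth: "fps_nth r n \<in> smooth_functions" and s_smooth: "fps_nth s n \<in> smooth_functions" for n
    using r s by (simp_all add: carrier_star_algebra)
  have eq_0: "fst z * fps_nth r 0 z = fst z ^ m * deep_zeros z" for z
    using star_nth_0[of s "fps_const deep_zeros" z] star_nth_0[of r "fps_const fst" z] eq
    by (simp add: m mult.commute)
  have eq_Suc: "fst z * fps_nth r (Suc n) z =
      fps_nth s (Suc n) z * deep_zeros z - partial_p (fps_nth r n) z" for n z
    using star_fst_right[of r n z] star_const_right[OF partial_x_deep_zeros, of s "Suc n" z] eq
    by simp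
  \<comment> \<open>Here \<open>d = m - n\<close> is the order in \<open>p\<close> still left.
    Multiplying by \<open>x ^ Suc n\<close> avoids dividing by \<open>x\<close>, at the cost of one
    more factor per degree.\<close>
  have "\<exists>h\<in>smooth_functions. \<exists>C. C \<noteq> 0 \<and> (\<forall>x. h (x, c) = C * x ^ m) \<and>
      (\<forall>x p. \<bar>p - c\<bar> < 1 / 2 \<longrightarrow> x ^ Suc n * fps_nth r n (x, p) = (p - c) ^ d * h (x, p))"
    if "n + d = m" for n d
    using that
  proof (induction n arbitrary: d)
    case 0
    have "(\<lambda>z. fst z ^ m * b (snd z)) \<in> smooth_functions"
      by (intro smooth_intros b)
    then show ?case
      using b(2) eq_0[of "(_, _)"] 0
      by (intro bexI[of _ "\<lambda>z. fst z ^ m * b (snd z)"] exI[of _ "b c"]) (auto simp: deep)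
  next
    case (Suc n)
    then obtain h C where h: "h \<in> smooth_functions" and C: "C \<noteq> 0" "\<And>x. h (x, c) = C * x ^ m"
      and strip: "\<And>x p. \<bar>p - c\<bar> < 1 / 2 \<Longrightarrow>
        x ^ Suc n * fps_nth r n (x, p) = (p - c) ^ Suc d * h (x, p)"
      using Suc.IH[of "Suc d"] by auto
    \<comment> \<open>Obtained by multiplying \<open>eq_Suc\<close> by \<open>x ^ Suc n\<close> and
      cancelling \<open>(p - c) ^ d\<close>. On \<open>p = c\<close> the first summand vanishes
      because of \<open>(p - c) ^ Suc n\<close>, so the new constant is
      \<open>- real (Suc d) * C\<close>, again nonzero.\<close>
    define h' where "h' = (\<lambda>z. fst z ^ Suc n * (snd z - c) ^ Suc n * fps_nth s (Suc n) z * b (snd z)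
      - (real (Suc d) * h z + (snd z - c) * partial_p h z))"
    have "h' \<in> smooth_functions"
      unfolding h'_def by (intro smooth_intros b h s_smooth)
    moreover have "h' (x, c) = (- real (Suc d) * C) * x ^ m" for x
      by (simp add: h'_def C algebra_simps)
    moreover have "x ^ Suc (Suc n) * fps_nth r (Suc n) (x, p) = (p - c) ^ d * h' (x, p)"
      if p: "\<bar>p - c\<bar> < 1 / 2" for x p
    proof -
      have "partial_p (\<lambda>z. fst z ^ Suc n * fps_nth r n z) (x, p) =
          x ^ Suc n * partial_p (fps_nth r n) (x, p)"
        using has_derivative_partial_p[OF smooth_imp_differentiable[OF r_smooth[of n]], of x p]
        by (auto simp: partial_p_def intro!: DERIV_imp_deriv DERIV_cmult)
      then have "x ^ Suc n * partial_p (fps_nth r n) (x, p) =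
          (p - c) ^ d * (real (Suc d) * h (x, p) + (p - c) * partial_p h (x, p))"
        using partial_p_strip[OF h _ p, of "\<lambda>z. fst z ^ Suc n * fps_nth r n z" d x] strip by simp
      moreover have "x ^ Suc (Suc n) * fps_nth r (Suc n) (x, p) = x ^ Suc n *
          (fps_nth s (Suc n) (x, p) * deep_zeros (x, p) - partial_p (fps_nth r n) (x, p))"
        using eq_Suc[of "(x, p)" n] by simp
      moreover have "deep_zeros (x, p) = (p - c) ^ d * (p - c) ^ Suc n * b p"
        using deep[OF p] Suc.prems by (metis add.commute power_add)
      ultimately show ?thesis
        by (simp add: h'_def algebra_simps)
    qed
    ultimately show ?case
      using C(1) by (intro bexI[of _ h'] exI[of _ "- real (Suc d) * C"]) auto
  qed
  then obtain h C where C: "C \<noteq> 0" and h: "\<And>x. h (x, c) = C * x ^ m"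
    and "\<And>x p. \<bar>p - c\<bar> < 1 / 2 \<Longrightarrow> x ^ Suc m * fps_nth r m (x, p) = (p - c) ^ 0 * h (x, p)"
    using add_0_right by metis
  then have div: "x ^ Suc m * fps_nth r m (x, c) = C * x ^ m" for x
    by simp
  \<comment> \<open>Cancelling \<open>x ^ m\<close> away from \<open>x = 0\<close> makes this
    function constantly \<open>C\<close>; by continuity it is \<open>C\<close> at 0 too, where it
    visibly vanishes.\<close>
  have "continuous_on UNIV (\<lambda>x. x * fps_nth r m (x, c))"
    by (intro continuous_intros continuous_on_compose2[OF smooth_imp_continuous[OF r_smooth[of m]]]) auto
  moreover have "x * fps_nth r m (x, c) = C" if "x \<in> - {0}" for x
    using div[of x] that by simp
  ultimately have "0 * fps_nth r m (0, c) = C"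
    using continuous_constant_on_closure[of "- {0}" "\<lambda>x. x * fps_nth r m (x, c)" C 0]
    by (simp add: closure_minus_zero)
  with C show False
    by simp
qed

theorem proposition5p1:
  fixes S S\<^sub>\<Omega> :: "(real \<times> real \<Rightarrow> real) fps set"
  defines "S \<equiv> plus_lambda x_powers"
    and "S\<^sub>\<Omega> \<equiv> plus_lambda (nonvanishing_on \<Omega>)"
  shows "multiplicative_subset star_algebra S
    \<and> S \<subseteq> S\<^sub>\<Omega> \<and> right_denominator_set star_algebra S\<^sub>\<Omega>
    \<and> \<not> right_Ore star_algebra S \<and> \<not> left_Ore star_algebra S"
proof (intro conjI)
  have power: "(\<lambda>(x, p). x ^ n) \<in> x_powers" for n
    by (simp add: x_powers_def)
  show "multiplicative_subset star_algebra S"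
    unfolding S_def
  proof (intro multiplicative_subset_plus_lambda x_powers_smooth)
    have "1 = (\<lambda>(x :: real, p :: real). x ^ 0)"
      by (auto simp: fun_eq_iff)
    then show "1 \<in> x_powers"
      using power by metis
    fix f g
    assume "f \<in> x_powers" "g \<in> x_powers"
    then obtain m n where "f = (\<lambda>(x, p). x ^ m)" "g = (\<lambda>(x, p). x ^ n)"
      by (auto simp: x_powers_def)
    then have "f * g = (\<lambda>(x, p). x ^ (m + n))"
      by (auto simp: fun_eq_iff power_add)
    then show "f * g \<in> x_powers"
      using power by metis
  qed
  have "x_powers \<subseteq> nonvanishing_on \<Omega>"
    using x_powers_smooth by (auto simp: x_powers_def nonvanishing_on_def \<Omega>_def)
  then show "S \<subseteq> S\<^sub>\<Omega>"
    by (auto simp: S_def S\<^sub>\<Omega>_def plus_lambda_def)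
  show "right_denominator_set star_algebra S\<^sub>\<Omega>"
    unfolding S\<^sub>\<Omega>_def by (rule right_denominator_set_nonvanishing[OF closure_Omega])
  have deep: "fps_const deep_zeros \<in> carrier star_algebra"
    by (rule fps_const_in_carrier[OF deep_zeros_smooth])
  show "\<not> right_Ore star_algebra S"
    using star_deep_zeros_not_divisible deep fst_in_plus_lambda
    unfolding right_Ore_def S_def star_algebra_simps by blast
  show "\<not> left_Ore star_algebra S"
    using fst_star_deep_zeros_not_divisible deep fst_in_plus_lambda
    unfolding left_Ore_def S_def star_algebra_simps by blast
qed

end
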